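(* Let $Y$ be a Banach space admitting an equivalent norm with property $(\beta)$. Then $\sup_{\ell\ge 1}c_Y(P^\omega_\ell)=\infty$. In particular, if $Y$ is a Banach space with property $(\beta_p)$ with $p\in(1,\infty)$ and constant $\gamma:=\gamma(Y)>0$, then for every $\ell\ge1$, $$c_Y(P^\omega_\ell)\ge 2\left(\frac{2\gamma}{3}\right)^{\frac1p}\ell^{\frac1p}.$$
   Context: For metric spaces $X,Y$, a map $f\colon X\to Y$ is a bi-Lipschitz embedding if it is one-to-one and both $f$ and $f^{-1}$ (defined on $f(X)$) are Lipschitz; its distortion is $\mathrm{dist}(f)=\mathrm{Lip}(f)\cdot\mathrm{Lip}(f^{-1})$. $c_Y(X)$ denotes the infimum of $\mathrm{dist}(f)$ over all bi-Lipschitz embeddings $f\colon X\to Y$, and $c_Y(X)=\infty$ if there are none. Parasol graphs: $P^\omega_1$ is the unweighted graph with vertices $r$ (root), $b$, $t_i$ ($i\in\mathbb N$) and $s$ (summit), and edges $\{r,b\}$, $\{b,t_i\}$, $\{t_i,s\}$ for all $i\in\mathbb N$; edges are directed upward, i.e. from $r$ towards $s$. For $\ell\ge2$, $P^\omega_\ell$ is obtained from $P^\omega_{\ell-1}$ by replacing each (directed) edge $(u,v)$ by a copy of $P^\omega_1$ whose root is identified with $u$ and whose summit is identified with $v$. Each graph is equipped with the shortest path metric on its vertex set. Property $(\beta)$: let $B_Y$ be the closed unit ball of $Y$, and for a sequence put $\mathrm{sep}(\{y_i\}_{i=1}^\infty)=\inf\{\|y_n-y_m\|: n\ne m\}$.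 A Banach space $Y$ has property $(\beta)$ if for any $\varepsilon>0$ there is $\delta(\varepsilon)\in(0,1)$ such that for every $x\in B_Y$ and every sequence $(y_i)_{i=1}^\infty\subset B_Y$ with $\mathrm{sep}(\{y_i\})\ge\varepsilon$ there is $i_0$ with $\left\|\frac{x-y_{i_0}}2\right\|\le 1-\delta(\varepsilon)$. The $(\beta)$-modulus is $$\bar\beta_Y(t)=1-\sup\left\{\inf_{i\ge1}\frac{\|x-y_i\|}{2}\colon x\in B_Y,\ (y_i)_{i=1}^\infty\subset B_Y,\ \mathrm{sep}(\{y_i\})\ge t\right\},$$ defined on an interval $[0,a]$ (those $t$ for which such sequences exist), where $a\in[1,2]$ depends on $Y$. $Y$ has property $(\beta_p)$ with constant $\gamma\in(0,\infty)$ if $\bar\beta_Y(t)\ge\gamma t^p$ for all $t\in[0,a]$. *)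

theory Defs
  imports "HOL-Analysis.Analysis"
begin

section \<open>Lipschitz distortion\<close>

definition Lip :: "'a metric \<Rightarrow> 'b metric \<Rightarrow> ('a \<Rightarrow> 'b) \<Rightarrow> real" where
  "Lip X Y f =
     Inf {K. 0 \<le> K \<and> (\<forall>x\<in>mspace X. \<forall>y\<in>mspace X. mdist Y (f x) (f y) \<le> K * mdist X x y)}"

definition bi_Lipschitz_embedding :: "'a metric \<Rightarrow> 'b metric \<Rightarrow> ('a \<Rightarrow> 'b) \<Rightarrow> bool" where
  "bi_Lipschitz_embedding X Y f \<longleftrightarrow>
     inj_on f (mspace X) \<and> Lipschitz_continuous_map X Y f \<and>
     Lipschitz_continuous_map (submetric Y (f ` mspace X)) X (inv_into (mspace X) f)"

definition distortion :: "'a metric \<Rightarrow> 'b metric \<Rightarrow> ('a \<Rightarrow> 'b) \<Rightarrow> real" where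
  "distortion X Y f =
     Lip X Y f * Lip (submetric Y (f ` mspace X)) X (inv_into (mspace X) f)"

text \<open>This is $c_Y(X)$. In \<^typ>\<open>ereal\<close> the infimum of the empty set is \<^term>\<open>\<infinity>::ereal\<close>.\<close>

definition least_distortion :: "'b metric \<Rightarrow> 'a metric \<Rightarrow> ereal" where
  "least_distortion Y X = (INF f \<in> {f. bi_Lipschitz_embedding X Y f}. ereal (distortion X Y f))"


section \<open>Equivalent norms and property $(\beta)$\<close>

definition equivalent_norm :: "('y::real_normed_vector \<Rightarrow> real) \<Rightarrow> bool" where
  "equivalent_norm N \<longleftrightarrow>
     (\<forall>x y. N (x + y) \<le> N x + N y) \<and>
     (\<forall>c x. N (c *\<^sub>R x) = \<bar>c\<bar> * N x) \<and>
     (\<exists>a>0. \<exists>b>0. \<forall>x. a * norm x \<le> N x \<and> N x \<le> b * norm x)"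

text \<open>The following notions take the norm as the argument \<open>N\<close>, so that they can be used both for
  the given norm and for an equivalent one.\<close>

definition sep :: "('y::real_vector \<Rightarrow> real) \<Rightarrow> (nat \<Rightarrow> 'y) \<Rightarrow> real" where
  "sep N y = (INF (n, m) \<in> {(n, m). n \<noteq> m}. N (y n - y m))"

definition property_beta :: "('y::real_vector \<Rightarrow> real) \<Rightarrow> bool" where
  "property_beta N \<longleftrightarrow>
     (\<forall>\<epsilon>>0. \<exists>\<delta>. 0 < \<delta> \<and> \<delta> < 1 \<and>
        (\<forall>x y. N x \<le> 1 \<and> (\<forall>i. N (y i) \<le> 1) \<and> sep N y \<ge> \<epsilon> \<longrightarrow>
           (\<exists>i. N ((x - y i) /\<^sub>R 2) \<le> 1 - \<delta>)))"

text \<open>The domain $[0,a]$ of the modulus: those $t \ge 0$ for which there is a $t$-separated sequence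
  in the unit ball. If the supremum $a$ of the possible separations is not attained, \<open>a\<close> itself
  is not in the domain (the modulus would involve the supremum of the empty set there).\<close>

definition beta_domain :: "('y::real_vector \<Rightarrow> real) \<Rightarrow> real set" where
  "beta_domain N = {t. 0 \<le> t \<and> (\<exists>y. (\<forall>i. N (y i) \<le> 1) \<and> sep N y \<ge> t)}"

definition beta_modulus :: "('y::real_vector \<Rightarrow> real) \<Rightarrow> real \<Rightarrow> real" where
  "beta_modulus N t =
     1 - Sup {INF i. N (x - y i) / 2 | x y. N x \<le> 1 \<and> (\<forall>i. N (y i) \<le> 1) \<and> sep N y \<ge> t}"

definition property_beta_power :: "('y::real_vector \<Rightarrow> real) \<Rightarrow> real \<Rightarrow> real \<Rightarrow> bool" where
  "property_beta_power N p \<gamma> \<longleftrightarrow> (\<forall>t \<in> beta_domain N. beta_modulus N t \<ge> \<gamma> * t powr p)"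


section \<open>Parasol graphs\<close>

text \<open>\<open>Base u v\<close> and \<open>Tip u v i\<close> are the vertices $b$ and $t_i$ of the copy of $P^\omega_1$ that
  replaces the directed edge \<open>(u, v)\<close>.\<close>

datatype pvertex = Root | Summit | Base pvertex pvertex | Tip pvertex pvertex nat

definition parasol_copy :: "pvertex \<Rightarrow> pvertex \<Rightarrow> (pvertex \<times> pvertex) set" where
  "parasol_copy u v =
     {(u, Base u v)} \<union> range (\<lambda>i. (Base u v, Tip u v i)) \<union> range (\<lambda>i. (Tip u v i, v))"

text \<open>Upward directed edges. Level \<open>0\<close> is a single edge, so that level \<open>1\<close> is $P^\omega_1$.\<close>

primrec parasol_edges :: "nat \<Rightarrow> (pvertex \<times> pvertex) set" where
  "parasol_edges 0 = {(Root, Summit)}"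
| "parasol_edges (Suc l) = (\<Union>(u, v) \<in> parasol_edges l. parasol_copy u v)"

lemma parasol_edges_1: "parasol_edges 1 = parasol_copy Root Summit"
  by simp

definition parasol_vertices :: "nat \<Rightarrow> pvertex set" where
  "parasol_vertices l = Field (parasol_edges l)"

text \<open>Shortest path metric of the underlying undirected graph: the \<open>n\<close>-th relational power of the
  symmetrised edge relation relates the end points of walks with \<open>n\<close> edges.\<close>

definition graph_dist :: "('a \<times> 'a) set \<Rightarrow> 'a \<Rightarrow> 'a \<Rightarrow> real" where
  "graph_dist E u v = real (LEAST n. (u, v) \<in> (E \<union> E\<inverse>) ^^ n)"

definition parasol :: "nat \<Rightarrow> pvertex metric" where
  "parasol l = metric (parasol_vertices l, graph_dist (parasol_edges l))"

lemma parasol_vertices_Suc: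
  "parasol_vertices (Suc l) = parasol_vertices l \<union>
     (\<Union>(u, v) \<in> parasol_edges l. insert (Base u v) (range (Tip u v)))"
proof -
  have copy: "Field (parasol_copy u v) = {u, v} \<union> insert (Base u v) (range (Tip u v))" for u v
    unfolding parasol_copy_def Field_def by blast
  have "parasol_vertices (Suc l) = (\<Union>(u, v) \<in> parasol_edges l. Field (parasol_copy u v))"
    by (auto simp: parasol_vertices_def Field_def)
  also have "\<dots> = (\<Union>(u, v) \<in> parasol_edges l. {u, v}) \<union>
      (\<Union>(u, v) \<in> parasol_edges l. insert (Base u v) (range (Tip u v)))"
    unfolding copy by blast
  also have "(\<Union>(u, v) \<in> parasol_edges l. {u, v}) = parasol_vertices l"
    by (auto simp: parasol_vertices_def Field_def)
  finally show ?thesis .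
qed

lemma parasol_edge_vertices:
  "(u, v) \<in> parasol_edges l \<Longrightarrow> u \<in> parasol_vertices l \<and> v \<in> parasol_vertices l"
  by (auto simp: parasol_vertices_def Field_def)

lemma parasol_vertices_closed:
  "(Base u v \<in> parasol_vertices l \<longrightarrow> u \<in> parasol_vertices l \<and> v \<in> parasol_vertices l) \<and>
   (Tip u v i \<in> parasol_vertices l \<longrightarrow> u \<in> parasol_vertices l \<and> v \<in> parasol_vertices l)"
proof (induction l)
  case 0
  show ?case by (simp add: parasol_vertices_def Field_def)
next
  case (Suc l)
  then show ?case
    unfolding parasol_vertices_Suc using parasol_edge_vertices by auto
qed

text \<open>The vertices \<open>Base u v\<close> and \<open>Tip u v i\<close> used to subdivide an edge are new; so the copies
  inserted at one level only meet in old vertices.\<close>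

lemma parasol_copy_fresh:
  assumes "(u, v) \<in> parasol_edges l"
  shows "Base u v \<notin> parasol_vertices l" and "Tip u v i \<notin> parasol_vertices l"
proof -
  have "\<forall>u v. (u, v) \<in> parasol_edges l \<longrightarrow>
          Base u v \<notin> parasol_vertices l \<and> (\<forall>i. Tip u v i \<notin> parasol_vertices l)"
  proof (induction l)
    case 0
    show ?case by (simp add: parasol_vertices_def Field_def)
  next
    case (Suc l)
    show ?case
    proof (intro allI impI)
      fix u v assume "(u, v) \<in> parasol_edges (Suc l)"
      then have "u \<notin> parasol_vertices l \<or> v \<notin> parasol_vertices l"
        using Suc.IH by (auto simp: parasol_copy_def)
      then show "Base u v \<notin> parasol_vertices (Suc l) \<and>
                 (\<forall>i. Tip u v i \<notin> parasol_vertices (Suc l))"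
        unfolding parasol_vertices_Suc
        using parasol_vertices_closed[of u v l] parasol_edge_vertices[of u v l] by auto
    qed
  qed
  with assms show "Base u v \<notin> parasol_vertices l" "Tip u v i \<notin> parasol_vertices l"
    by blast+
qed

lemma Metric_space_graph_dist:
  assumes conn: "\<And>u v. u \<in> V \<Longrightarrow> v \<in> V \<Longrightarrow> (u, v) \<in> (E \<union> E\<inverse>)\<^sup>*"
  shows "Metric_space V (graph_dist E)"
proof -
  define S where "S = E \<union> E\<inverse>"
  have "sym S" by (auto simp: S_def sym_def)
  then have inv: "S\<inverse> = S" by (simp add: sym_conv_converse_eq)
  have symS: "(u, v) \<in> S ^^ n \<longleftrightarrow> (v, u) \<in> S ^^ n" for u v n
  proof -
    have "(S ^^ n)\<inverse> = S ^^ n"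
    proof (induction n)
      case (Suc n)
      have "(S ^^ Suc n)\<inverse> = S\<inverse> O (S ^^ n)\<inverse>" by (simp add: converse_relcomp)
      also have "\<dots> = S ^^ Suc n" by (simp only: inv Suc.IH relpow_commute relpow.simps)
      finally show ?case .
    qed simp
    then show ?thesis by blast
  qed
  have at: "(u, v) \<in> S ^^ (LEAST n. (u, v) \<in> S ^^ n)" if "u \<in> V" "v \<in> V" for u v
    using conn[OF that] unfolding S_def[symmetric] rtrancl_power by (meson LeastI_ex)
  show ?thesis
  proof
    fix x y z
    show "0 \<le> graph_dist E x y" by (simp add: graph_dist_def)
    show "graph_dist E x y = graph_dist E y x"
      by (simp add: graph_dist_def S_def[symmetric] symS[of x y])
    show "graph_dist E x y = 0 \<longleftrightarrow> x = y" if "x \<in> V" "y \<in> V"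
    proof
      assume "graph_dist E x y = 0"
      with at[OF that] show "x = y" by (simp add: graph_dist_def S_def[symmetric])
    next
      assume "x = y"
      then have "(x, y) \<in> S ^^ 0" by simp
      then show "graph_dist E x y = 0"
        unfolding graph_dist_def S_def[symmetric] by (simp only: Least_eq_0)
    qed
    show "graph_dist E x z \<le> graph_dist E x y + graph_dist E y z"
      if "x \<in> V" "y \<in> V" "z \<in> V"
    proof -
      have "(x, z) \<in> S ^^ ((LEAST n. (x, y) \<in> S ^^ n) + (LEAST n. (y, z) \<in> S ^^ n))"
        using at[OF that(1,2)] at[OF that(2,3)] by (auto simp: relpow_add)
      then show ?thesis
        unfolding graph_dist_def S_def[symmetric] of_nat_add[symmetric] of_nat_le_iff
        by (rule Least_le)
    qed
  qed
qed

lemma parasol_connected: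
  assumes "u \<in> parasol_vertices l" "v \<in> parasol_vertices l"
  shows "(u, v) \<in> (parasol_edges l \<union> (parasol_edges l)\<inverse>)\<^sup>*"
proof -
  define S where "S = (\<lambda>l. parasol_edges l \<union> (parasol_edges l)\<inverse>)"
  have sym: "sym ((S l)\<^sup>*)" for l
    by (rule sym_rtrancl) (auto simp: S_def sym_def)
  have "\<forall>w \<in> parasol_vertices l. (Root, w) \<in> (S l)\<^sup>*"
  proof (induction l)
    case 0
    show ?case by (auto simp: parasol_vertices_def S_def)
  next
    case (Suc l)
    have copy: "(u, Base u v) \<in> (S (Suc l))\<^sup>* \<and> (u, Tip u v i) \<in> (S (Suc l))\<^sup>* \<and>
                (u, v) \<in> (S (Suc l))\<^sup>*" if "(u, v) \<in> parasol_edges l" for u v i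
    proof -
      have "(u, Base u v) \<in> S (Suc l)" "(Base u v, Tip u v i) \<in> S (Suc l)"
           "(Tip u v i, v) \<in> S (Suc l)"
        using that by (auto simp: S_def parasol_copy_def intro!: bexI[of _ "(u, v)"])
      then show ?thesis by (meson r_into_rtrancl rtrancl.rtrancl_into_rtrancl)
    qed
    have "S l \<subseteq> (S (Suc l))\<^sup>*"
      using copy symD[OF sym[of "Suc l"]] by (auto simp: S_def)
    then have old: "(S l)\<^sup>* \<subseteq> (S (Suc l))\<^sup>*"
      by (simp add: rtrancl_subset_rtrancl)
    show ?case
    proof
      fix w assume "w \<in> parasol_vertices (Suc l)"
      then consider "w \<in> parasol_vertices l"
        | u v i where "(u, v) \<in> parasol_edges l" "w = Base u v \<or> w = Tip u v i"
        unfolding parasol_vertices_Suc by blast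
      then show "(Root, w) \<in> (S (Suc l))\<^sup>*"
      proof cases
        case 1
        then show ?thesis using Suc.IH old by blast
      next
        case 2
        then have "(Root, u) \<in> (S (Suc l))\<^sup>*"
          using Suc.IH old parasol_edge_vertices by blast
        then show ?thesis using 2 copy by (meson rtrancl_trans)
      qed
    qed
  qed
  then show ?thesis
    using assms symD[OF sym[of l]] unfolding S_def by (meson rtrancl_trans)
qed

lemma Metric_space_parasol: "Metric_space (parasol_vertices l) (graph_dist (parasol_edges l))"
  by (rule Metric_space_graph_dist) (rule parasol_connected)

lemma mspace_parasol [simp]: "mspace (parasol l) = parasol_vertices l"
  and mdist_parasol [simp]: "mdist (parasol l) = graph_dist (parasol_edges l)"
  by (simp_all add: parasol_def Metric_space.mspace_metric[OF Metric_space_parasol]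
        Metric_space.mdist_metric[OF Metric_space_parasol])

end

theory Submission
  imports Defs
begin

text \<open>
  The proof follows one embedding \<open>f\<close> down the levels of the parasol graph. Normalise \<open>f\<close> so that
  it does not contract distances, and let \<open>L\<close> bound the lengths of the images of the edges. In a
  copy of $P^\omega_1$ with vertices $r, b, t_i, s$ the points $f(t_i)$ all lie within \<open>L\<close> of
  $f(b)$, are \<open>2\<close>-separated, and the segment from $f(r)$ to $f(b)$ has length at most \<open>L\<close>.
  Rescaled by \<open>L\<close> this is the situation of property $(\beta)$ with separation $2/L$: up to an
  arbitrarily small error, some tip satisfies $\|f(t_i) - f(r)\| \le 2L(1 - \beta)$, where \<open>\<beta>\<close> is
  the gap that the property provides. Going from there to $f(s)$ gives
  $\|f(s) - f(r)\| \le 3L(1 - 2\beta/3)$. Since $d(r,s) = 3$, the restriction of \<open>f\<close> to the coarser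
  parasol, whose edges are the pairs \<open>(r, s)\<close>, has the smaller edge bound \<open>L (1 - 2 * \<beta> / 3)\<close> in
  the rescaled metric and still does not contract (lemma \<open>coarser_edges_shorter\<close>).

  The bound can never fall below \<open>1\<close>, so the number of levels is controlled by how fast it decreases.
  This is measured by a function \<open>\<Phi>\<close> of the edge bound that drops by at least \<open>c\<close> at each level
  (lemma \<open>levels_le_energy\<close>). For property $(\beta)$ the gap is bounded below as long as the
  edge bound is at most \<open>D\<close>, and \<open>\<Phi> L = L\<close> works; for property $(\beta_p)$ one has
  $\beta = \gamma (2/L)^p$, and $\Phi(L) = L^p$ drops by $c = (2\gamma/3)2^p$.
\<close>

section \<open>Distances in parasol graphs\<close>

lemma parasol_vertices_mono: "parasol_vertices k \<subseteq> parasol_vertices (k + m)"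
proof (induction m)
  case (Suc m)
  then show ?case using parasol_vertices_Suc[of "k + m"] by auto
qed simp

lemma parasol_edges_nonempty: "\<exists>u v. (u, v) \<in> parasol_edges k"
proof (induction k)
  case (Suc k)
  then show ?case by (fastforce simp: parasol_copy_def)
qed simp

lemma parasol_edge_neq:
  assumes "(u, v) \<in> parasol_edges k"
  shows "u \<noteq> v"
proof (cases k)
  case 0
  with assms show ?thesis by simp
next
  case (Suc j)
  with assms obtain a b where ab: "(a, b) \<in> parasol_edges j" and "(u, v) \<in> parasol_copy a b"
    by auto
  then show ?thesis
    using parasol_copy_fresh[OF ab] parasol_edge_vertices[OF ab] by (auto simp: parasol_copy_def)
qed

text \<open>Interpolating linearly along each subdivided edge distributes the increment evenly over the
  three new edges. The copies meet only in old vertices, so the interpolations are compatible.\<close>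

lemma extend_potential:
  fixes g :: "pvertex \<Rightarrow> real"
  assumes g: "\<And>u v. (u, v) \<in> parasol_edges k \<Longrightarrow> \<bar>g u - g v\<bar> \<le> M"
  shows "\<exists>h. (\<forall>x\<in>parasol_vertices k. h x = g x) \<and>
             (\<forall>u v. (u, v) \<in> parasol_edges (Suc k) \<longrightarrow> \<bar>h u - h v\<bar> \<le> M / 3)"
proof -
  define h where "h = (\<lambda>x. if x \<in> parasol_vertices k then g x else
    (case x of Base u v \<Rightarrow> g u + (g v - g u) / 3 | Tip u v i \<Rightarrow> g u + 2 * (g v - g u) / 3 | _ \<Rightarrow> 0))"
  have "\<bar>h x - h y\<bar> \<le> M / 3" if "(x, y) \<in> parasol_edges (Suc k)" for x y
  proof -
    from that obtain u v where e: "(u, v) \<in> parasol_edges k" and xy: "(x, y) \<in> parasol_copy u v"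
      by auto
    have old: "h u = g u" "h v = g v" using parasol_edge_vertices[OF e] by (simp_all add: h_def)
    have base: "h (Base u v) = g u + (g v - g u) / 3"
      and tip: "h (Tip u v i) = g u + 2 * (g v - g u) / 3" for i
      using parasol_copy_fresh[OF e] by (simp_all add: h_def)
    have "\<bar>h u - h (Base u v)\<bar> \<le> M / 3"
      using g[OF e] by (simp add: old base abs_le_iff field_simps)
    moreover have "\<bar>h (Base u v) - h (Tip u v i)\<bar> \<le> M / 3" for i
      using g[OF e] by (simp add: base tip abs_le_iff field_simps)
    moreover have "\<bar>h (Tip u v i) - h v\<bar> \<le> M / 3" for i
      using g[OF e] by (simp add: old tip abs_le_iff field_simps)
    ultimately show ?thesis using xy by (auto simp: parasol_copy_def)
  qed
  then show ?thesis by (intro exI[of _ h]) (auto simp: h_def)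
qed

lemma extend_potential_levels:
  fixes g :: "pvertex \<Rightarrow> real"
  assumes g: "\<And>u v. (u, v) \<in> parasol_edges k \<Longrightarrow> \<bar>g u - g v\<bar> \<le> M"
  shows "\<exists>h. (\<forall>x\<in>parasol_vertices k. h x = g x) \<and>
             (\<forall>u v. (u, v) \<in> parasol_edges (k + m) \<longrightarrow> \<bar>h u - h v\<bar> \<le> M / 3 ^ m)"
proof (induction m)
  case 0
  then show ?case using g by auto
next
  case (Suc m)
  then obtain h where h: "\<forall>x\<in>parasol_vertices k. h x = g x"
    and hb: "\<And>u v. (u, v) \<in> parasol_edges (k + m) \<Longrightarrow> \<bar>h u - h v\<bar> \<le> M / 3 ^ m"
    by blast
  from extend_potential[of "k + m" h, OF hb]
  obtain h' where "\<forall>x\<in>parasol_vertices (k + m). h' x = h x"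
    "\<forall>u v. (u, v) \<in> parasol_edges (Suc (k + m)) \<longrightarrow> \<bar>h' u - h' v\<bar> \<le> M / 3 ^ m / 3"
    by blast
  with h parasol_vertices_mono[of k m] show ?case
    by (intro exI[of _ h']) (auto simp: mult.commute)
qed

lemma walk_potential:
  fixes g :: "'a \<Rightarrow> real"
  assumes "\<And>u v. (u, v) \<in> E \<Longrightarrow> \<bar>g u - g v\<bar> \<le> M"
  shows "(x, y) \<in> (E \<union> E\<inverse>) ^^ n \<Longrightarrow> \<bar>g x - g y\<bar> \<le> M * real n"
proof (induction n arbitrary: y)
  case (Suc n)
  then obtain z where z: "(x, z) \<in> (E \<union> E\<inverse>) ^^ n" "(z, y) \<in> E \<union> E\<inverse>" by auto
  then have "\<bar>g z - g y\<bar> \<le> M" using assms[of z y] assms[of y z] by auto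
  with Suc.IH[OF z(1)] show ?case by (simp add: algebra_simps)
qed simp

text \<open>Potentials certify lower bounds for distances: it is enough to control a function on the
  edges of the level where it is defined, however fine the graph in which the distance is measured.\<close>

lemma potential_le_graph_dist:
  fixes g :: "pvertex \<Rightarrow> real"
  assumes g: "\<And>u v. (u, v) \<in> parasol_edges k \<Longrightarrow> \<bar>g u - g v\<bar> \<le> 1"
    and x: "x \<in> parasol_vertices k" and y: "y \<in> parasol_vertices k"
  shows "\<bar>g x - g y\<bar> * 3 ^ m \<le> graph_dist (parasol_edges (k + m)) x y"
proof -
  let ?E = "parasol_edges (k + m)"
  from extend_potential_levels[of k g 1 m, OF g]
  obtain h where h: "\<forall>x\<in>parasol_vertices k. h x = g x"
    and hb: "\<And>u v. (u, v) \<in> ?E \<Longrightarrow> \<bar>h u - h v\<bar> \<le> 1 / 3 ^ m"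
    by blast
  have "(x, y) \<in> (?E \<union> ?E\<inverse>)\<^sup>*"
    using parasol_connected x y parasol_vertices_mono[of k m] by blast
  then have "(x, y) \<in> (?E \<union> ?E\<inverse>) ^^ (LEAST n. (x, y) \<in> (?E \<union> ?E\<inverse>) ^^ n)"
    unfolding rtrancl_power by (meson LeastI_ex)
  from walk_potential[of ?E h, OF hb this] h x y show ?thesis
    by (simp add: graph_dist_def field_simps)
qed

lemma graph_dist_edge_le_1:
  assumes "(u, v) \<in> E"
  shows "graph_dist E u v \<le> 1"
proof -
  have "(LEAST n. (u, v) \<in> (E \<union> E\<inverse>) ^^ n) \<le> 1"
    by (rule Least_le) (use assms in simp)
  then show ?thesis by (simp add: graph_dist_def)
qed

text \<open>The potential is the indicator of one of the two vertices.\<close>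

lemma graph_dist_coarse_vertices:
  assumes "x \<in> parasol_vertices k" "y \<in> parasol_vertices k" "x \<noteq> y"
  shows "3 ^ m \<le> graph_dist (parasol_edges (k + m)) x y"
  using potential_le_graph_dist[of k "\<lambda>z. if z = x then 1 else 0", OF _ assms(1,2)] assms(3)
  by (auto split: if_splits)

text \<open>The potential is \<open>1\<close> at one tip, \<open>-1\<close> at the other and \<open>0\<close> elsewhere; it changes by at most
  \<open>1\<close> along each edge because two tips of the newest level are never adjacent.\<close>

lemma graph_dist_tips:
  assumes e: "(u, v) \<in> parasol_edges k" and ij: "i \<noteq> j"
  shows "2 * 3 ^ m \<le> graph_dist (parasol_edges (Suc k + m)) (Tip u v i) (Tip u v j)"
proof -
  define g :: "pvertex \<Rightarrow> real"
    where "g = (\<lambda>z. if z = Tip u v i then 1 else if z = Tip u v j then - 1 else 0)"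
  have fresh: "g z = 0" if "z \<in> parasol_vertices k" for z
    using that parasol_copy_fresh[OF e] by (auto simp: g_def)
  have "\<bar>g x - g y\<bar> \<le> 1" if "(x, y) \<in> parasol_edges (Suc k)" for x y
  proof -
    from that obtain a b where ab: "(a, b) \<in> parasol_edges k" and xy: "(x, y) \<in> parasol_copy a b"
      by auto
    have "g a = 0" "g b = 0" using fresh parasol_edge_vertices[OF ab] by auto
    moreover have "g (Base a b) = 0" "\<bar>g z\<bar> \<le> 1" for z by (auto simp: g_def)
    ultimately show ?thesis using xy by (auto simp: parasol_copy_def)
  qed
  moreover have tip: "Tip u v n \<in> parasol_vertices (Suc k)" for n
    using e by (auto simp: parasol_vertices_Suc)
  ultimately have "\<bar>g (Tip u v i) - g (Tip u v j)\<bar> * 3 ^ m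
      \<le> graph_dist (parasol_edges (Suc k + m)) (Tip u v i) (Tip u v j)"
    by (intro potential_le_graph_dist[OF _ tip tip])
  with ij show ?thesis by (simp add: g_def)
qed

section \<open>The gap given by property $(\beta)$\<close>

text \<open>A common form of the two hypotheses on the norm. The slack \<open>\<eta>\<close> is there because the modulus
  only controls an infimum over the sequence, which need not be attained.\<close>

definition beta_gap :: "('y::real_vector \<Rightarrow> real) \<Rightarrow> real \<Rightarrow> real \<Rightarrow> bool" where
  "beta_gap N t b \<longleftrightarrow>
     (\<forall>x y. N x \<le> 1 \<and> (\<forall>i. N (y i) \<le> 1) \<and> sep N y \<ge> t \<longrightarrow>
        (\<forall>\<eta>>0. \<exists>i. N (x - y i) / 2 \<le> 1 - b + \<eta>))"

lemma equivalent_norm_norm: "equivalent_norm (norm :: 'y::real_normed_vector \<Rightarrow> real)"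
  unfolding equivalent_norm_def by (auto simp: norm_triangle_ineq intro!: exI[of _ 1])

lemma equivalent_norm_scaleR: "equivalent_norm N \<Longrightarrow> N (c *\<^sub>R x) = \<bar>c\<bar> * N x"
  and equivalent_norm_triangle: "equivalent_norm N \<Longrightarrow> N (x + y) \<le> N x + N y"
  by (auto simp: equivalent_norm_def)

lemma equivalent_norm_minus_commute:
  assumes "equivalent_norm N" shows "N (x - y) = N (y - x)"
  using equivalent_norm_scaleR[OF assms, of "- 1" "x - y"] by simp

lemma property_beta_gap:
  fixes N :: "'a::real_normed_vector \<Rightarrow> real"
  assumes N: "equivalent_norm N" and beta: "property_beta N" and "0 < \<epsilon>"
  shows "\<exists>\<delta>>0. \<forall>t\<ge>\<epsilon>. beta_gap N t \<delta>"
proof -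
  from beta[unfolded property_beta_def, rule_format, OF \<open>0 < \<epsilon>\<close>]
  obtain \<delta> where "0 < \<delta>" and \<delta>:
    "\<forall>x y. N x \<le> 1 \<and> (\<forall>i. N (y i) \<le> 1) \<and> sep N y \<ge> \<epsilon> \<longrightarrow>
       (\<exists>i. N ((x - y i) /\<^sub>R 2) \<le> 1 - \<delta>)"
    by (elim exE conjE)
  have half: "N (z /\<^sub>R 2) = N z / 2" for z by (simp add: equivalent_norm_scaleR[OF N])
  have "beta_gap N t \<delta>" if t: "\<epsilon> \<le> t" for t
    unfolding beta_gap_def
  proof (intro allI impI; elim conjE)
    fix x :: 'a and y :: "nat \<Rightarrow> 'a" and \<eta> :: real
    assume "N x \<le> 1" "\<forall>i. N (y i) \<le> 1" "t \<le> sep N y" "0 < \<eta>"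
    then have "\<exists>i. N ((x - y i) /\<^sub>R 2) \<le> 1 - \<delta>" using t by (intro \<delta>[rule_format]) auto
    then obtain i where "N (x - y i) / 2 \<le> 1 - \<delta>" unfolding half by blast
    with \<open>0 < \<eta>\<close> show "\<exists>i. N (x - y i) / 2 \<le> 1 - \<delta> + \<eta>" by (intro exI[of _ i]) simp
  qed
  with \<open>0 < \<delta>\<close> show ?thesis by blast
qed

lemma property_beta_power_gap:
  fixes t p \<gamma> :: real
  assumes power: "property_beta_power (norm :: 'y::real_normed_vector \<Rightarrow> real) p \<gamma>" and "0 \<le> t"
  shows "beta_gap (norm :: 'y \<Rightarrow> real) t (\<gamma> * t powr p)"
  unfolding beta_gap_def
proof (intro allI impI; elim conjE)
  fix x :: 'y and y :: "nat \<Rightarrow> 'y" and \<eta> :: real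
  assume x: "norm x \<le> 1" and y: "\<forall>i. norm (y i) \<le> 1" and s: "t \<le> sep norm y" and "0 < \<eta>"
  define S where "S = {INF i. norm (x - y i) / 2 | (x::'y) y.
    norm x \<le> 1 \<and> (\<forall>i::nat. norm (y i) \<le> 1) \<and> sep norm y \<ge> t}"
  have bdd: "bdd_above S"
  proof (rule bdd_aboveI[of _ 1])
    fix r assume "r \<in> S"
    then obtain x :: 'y and y :: "nat \<Rightarrow> 'y" where r: "r = (INF i. norm (x - y i) / 2)"
      and xy: "norm x \<le> 1" "\<forall>i. norm (y i) \<le> 1"
      by (auto simp: S_def)
    have "r \<le> norm (x - y 0) / 2"
      unfolding r by (intro cINF_lower bdd_belowI[of _ 0]) auto
    also have "\<dots> \<le> 1"
      using norm_triangle_ineq4[of x "y 0"] xy(1) spec[OF xy(2), of 0] by linarith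
    finally show "r \<le> 1" .
  qed
  have "t \<in> beta_domain (norm :: 'y \<Rightarrow> real)"
    using \<open>0 \<le> t\<close> y s by (auto simp: beta_domain_def)
  with power have "\<gamma> * t powr p \<le> 1 - Sup S"
    unfolding property_beta_power_def beta_modulus_def S_def by blast
  moreover have "(INF i. norm (x - y i) / 2) \<le> Sup S"
    by (rule cSup_upper[OF _ bdd]) (use x y s in \<open>auto simp: S_def\<close>)
  ultimately have "(INF i. norm (x - y i) / 2) < 1 - \<gamma> * t powr p + \<eta>"
    using \<open>0 < \<eta>\<close> by linarith
  moreover have "bdd_below (range (\<lambda>i. norm (x - y i) / 2))"
    by (rule bdd_belowI[of _ 0]) auto
  ultimately obtain i where "norm (x - y i) / 2 < 1 - \<gamma> * t powr p + \<eta>"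
    by (auto simp: cINF_less_iff)
  then show "\<exists>i. norm (x - y i) / 2 \<le> 1 - \<gamma> * t powr p + \<eta>" by (meson less_imp_le)
qed

lemma sep_geI:
  assumes "\<And>n m. n \<noteq> m \<Longrightarrow> t \<le> N (y n - y m)"
  shows "t \<le> sep N y"
proof -
  have "(0, Suc 0) \<in> {(n, m). n \<noteq> m}" by simp
  then have "{(n::nat, m). n \<noteq> m} \<noteq> {}" by blast
  then show ?thesis unfolding sep_def using assms by (intro cINF_greatest) auto
qed

text \<open>The points \<open>t i\<close> and \<open>r\<close> lie in the ball of radius \<open>R\<close> about \<open>b\<close>, so the gap makes some
  \<open>t i\<close> closer to \<open>r\<close> than the trivial \<open>2 * R\<close>; the triangle inequality through this point gives the
  bound.\<close>

lemma beta_gap_detour: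
  fixes N :: "'y::real_normed_vector \<Rightarrow> real"
  assumes N: "equivalent_norm N" and "0 < R"
    and gap: "beta_gap N \<tau> \<beta>"
    and rb: "N (b - r) \<le> R" and bt: "\<And>i::nat. N (b - t i) \<le> R" and ts: "\<And>i. N (s - t i) \<le> R"
    and far: "\<And>i j. i \<noteq> j \<Longrightarrow> \<tau> * R \<le> N (t i - t j)"
  shows "N (s - r) \<le> 3 * R * (1 - 2 * \<beta> / 3)"
proof -
  have scale: "N (z /\<^sub>R R) = N z / R" for z
    using \<open>0 < R\<close> by (simp add: equivalent_norm_scaleR[OF N] divide_inverse mult.commute)
  define x where "x = (b - r) /\<^sub>R R"
  define y where "y = (\<lambda>i. (b - t i) /\<^sub>R R)"
  have diff: "y i - y j = (t j - t i) /\<^sub>R R" "x - y i = (t i - r) /\<^sub>R R" for i j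
    by (simp_all add: x_def y_def flip: scaleR_diff_right)
  have unit: "N x \<le> 1" "N (y i) \<le> 1" for i
    using rb bt[of i] \<open>0 < R\<close> by (simp_all add: x_def y_def scale)
  have "\<tau> \<le> sep N y"
  proof (rule sep_geI)
    fix n m :: nat assume "n \<noteq> m"
    with far[of m n] \<open>0 < R\<close> show "\<tau> \<le> N (y n - y m)"
      by (simp add: diff scale pos_le_divide_eq)
  qed
  with gap unit have near: "\<exists>i. N (x - y i) / 2 \<le> 1 - \<beta> + \<eta>" if "0 < \<eta>" for \<eta>
    using that unfolding beta_gap_def by blast
  show ?thesis
  proof (rule field_le_epsilon)
    fix e :: real assume "0 < e"
    then obtain i where "N (x - y i) / 2 \<le> 1 - \<beta> + e / (2 * R)"
      using near[of "e / (2 * R)"] \<open>0 < R\<close> by auto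
    moreover have "N (x - y i) = N (t i - r) / R" by (simp only: diff scale)
    ultimately have "N (t i - r) \<le> 2 * R * (1 - \<beta>) + e"
      using \<open>0 < R\<close> by (simp add: field_simps)
    moreover have "N (s - r) \<le> N (s - t i) + N (t i - r)"
      using equivalent_norm_triangle[OF N, of "s - t i" "t i - r"] by simp
    ultimately show "N (s - r) \<le> 3 * R * (1 - 2 * \<beta> / 3) + e"
      using ts[of i] by (simp add: algebra_simps)
  qed
qed

section \<open>Descending through the levels\<close>

text \<open>The target norm \<open>N\<close> is not necessarily the one in which distortion is measured.\<close>

definition noncontractive :: "('y::real_vector \<Rightarrow> real) \<Rightarrow> nat \<Rightarrow> (pvertex \<Rightarrow> 'y) \<Rightarrow> bool" where
  "noncontractive N l f \<longleftrightarrow>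
     (\<forall>x\<in>parasol_vertices l. \<forall>y\<in>parasol_vertices l.
        graph_dist (parasol_edges l) x y \<le> N (f x - f y))"

text \<open>The vertices of level \<open>k\<close> are regarded inside a graph that is finer by \<open>m\<close> levels, hence the
  factor \<open>3 ^ m\<close>.\<close>

definition edges_within ::
    "('y::real_vector \<Rightarrow> real) \<Rightarrow> nat \<Rightarrow> nat \<Rightarrow> (pvertex \<Rightarrow> 'y) \<Rightarrow> real \<Rightarrow> bool" where
  "edges_within N k m f L \<longleftrightarrow> (\<forall>(u, v)\<in>parasol_edges k. N (f v - f u) \<le> L * 3 ^ m)"

text \<open>The ends of an edge of level \<open>k\<close> have distance at least \<open>3 ^ m\<close> in the finer graph.\<close>

lemma edges_within_ge_1:
  assumes N: "equivalent_norm N" and f: "noncontractive N (k + m) f" and L: "edges_within N k m f L"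
  shows "1 \<le> L"
proof -
  obtain u v where e: "(u, v) \<in> parasol_edges k" using parasol_edges_nonempty by blast
  have uv: "u \<in> parasol_vertices k" "v \<in> parasol_vertices k" "u \<noteq> v"
    using parasol_edge_vertices[OF e] parasol_edge_neq[OF e] by auto
  have "3 ^ m \<le> graph_dist (parasol_edges (k + m)) v u"
    using graph_dist_coarse_vertices uv by metis
  also have "\<dots> \<le> N (f v - f u)"
    using f uv parasol_vertices_mono[of k m] by (auto simp: noncontractive_def)
  also have "\<dots> \<le> L * 3 ^ m" using L e by (auto simp: edges_within_def)
  finally show ?thesis by simp
qed

text \<open>The self-improvement step: tips of the same copy are at distance two edges, so their images are
  \<open>2 / L\<close>-separated relative to the length of the edges.\<close>

lemma coarser_edges_shorter:
  fixes N :: "'y::real_normed_vector \<Rightarrow> real"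
  assumes N: "equivalent_norm N" and f: "noncontractive N (Suc k + m) f"
    and L: "edges_within N (Suc k) m f L" and gap: "beta_gap N (2 / L) \<beta>"
  shows "edges_within N k (Suc m) f (L * (1 - 2 * \<beta> / 3))"
  unfolding edges_within_def
proof clarify
  fix u v assume e: "(u, v) \<in> parasol_edges k"
  have "1 \<le> L" by (rule edges_within_ge_1[OF N f L])
  have edge: "N (f y - f x) \<le> L * 3 ^ m" if "(x, y) \<in> parasol_copy u v" for x y
    using L e that by (auto simp: edges_within_def)
  have "N (f v - f u) \<le> 3 * (L * 3 ^ m) * (1 - 2 * \<beta> / 3)"
  proof (rule beta_gap_detour[OF N _ gap])
    show "0 < L * 3 ^ m" using \<open>1 \<le> L\<close> by simp
    show "N (f (Base u v) - f u) \<le> L * 3 ^ m"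
      by (rule edge) (simp add: parasol_copy_def)
    fix i j :: nat
    have "N (f (Tip u v i) - f (Base u v)) \<le> L * 3 ^ m"
      by (rule edge) (simp add: parasol_copy_def)
    then show "N (f (Base u v) - f (Tip u v i)) \<le> L * 3 ^ m"
      by (simp add: equivalent_norm_minus_commute[OF N])
    show "N (f v - f (Tip u v i)) \<le> L * 3 ^ m"
      by (rule edge) (simp add: parasol_copy_def)
    assume "i \<noteq> j"
    have tip: "Tip u v n \<in> parasol_vertices (Suc k + m)" for n
    proof -
      have "Tip u v n \<in> parasol_vertices (Suc k)" using e by (auto simp: parasol_vertices_Suc)
      then show ?thesis using parasol_vertices_mono by blast
    qed
    have "2 * 3 ^ m \<le> graph_dist (parasol_edges (Suc k + m)) (Tip u v i) (Tip u v j)"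
      by (rule graph_dist_tips[OF e \<open>i \<noteq> j\<close>])
    also have "\<dots> \<le> N (f (Tip u v i) - f (Tip u v j))"
      using f tip unfolding noncontractive_def by blast
    finally show "2 / L * (L * 3 ^ m) \<le> N (f (Tip u v i) - f (Tip u v j))"
      using \<open>1 \<le> L\<close> by simp
  qed
  then show "N (f v - f u) \<le> L * (1 - 2 * \<beta> / 3) * 3 ^ Suc m" by (simp add: mult_ac)
qed

text \<open>Each level costs \<open>c\<close> units of the energy \<open>\<Phi>\<close>, which stays nonnegative because the edge bound
  stays at least \<open>1\<close> down to the coarsest level.\<close>

lemma levels_le_energy:
  fixes N :: "'y::real_normed_vector \<Rightarrow> real" and \<Phi> :: "real \<Rightarrow> real"
  assumes N: "equivalent_norm N" and f: "noncontractive N l f" and D: "edges_within N l 0 f D"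
    and gap: "\<And>L. 1 \<le> L \<Longrightarrow> L \<le> D \<Longrightarrow> beta_gap N (2 / L) (\<beta> L) \<and> 0 \<le> \<beta> L"
    and drop: "\<And>L. 1 \<le> L \<Longrightarrow> L \<le> D \<Longrightarrow> 1 \<le> L * (1 - 2 * \<beta> L / 3) \<Longrightarrow>
                 \<Phi> (L * (1 - 2 * \<beta> L / 3)) + c \<le> \<Phi> L"
    and nonneg: "\<And>L. 1 \<le> L \<Longrightarrow> 0 \<le> \<Phi> L"
  shows "c * real l \<le> \<Phi> D"
proof -
  \<comment> \<open>\<open>m\<close> counts the levels that have been removed; \<open>L \<le> D\<close> keeps \<open>gap\<close> and \<open>drop\<close> applicable.\<close>
  have "\<exists>L\<ge>1. L \<le> D \<and> edges_within N (l - m) m f L \<and> \<Phi> L + c * real m \<le> \<Phi> D" if "m \<le> l" for m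
    using that
  proof (induction m)
    case 0
    then show ?case using edges_within_ge_1[of N l 0 f D] N f D by auto
  next
    case (Suc m)
    define k where "k = l - Suc m"
    have k: "l - m = Suc k" "l = Suc k + m" "l - Suc m = k" using Suc.prems by (auto simp: k_def)
    from Suc obtain L where L: "1 \<le> L" "L \<le> D" "edges_within N (Suc k) m f L"
      and \<Phi>L: "\<Phi> L + c * real m \<le> \<Phi> D" by (auto simp: k(1))
    define L' where "L' = L * (1 - 2 * \<beta> L / 3)"
    have \<beta>: "beta_gap N (2 / L) (\<beta> L)" "0 \<le> \<beta> L" using gap L by auto
    have f': "noncontractive N (Suc k + m) f" using f k(2) by simp
    have edges: "edges_within N k (Suc m) f L'"
      unfolding L'_def using coarser_edges_shorter[OF N f' L(3) \<beta>(1)] .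
    have "noncontractive N (k + Suc m) f" using f' by simp
    then have "1 \<le> L'" using edges_within_ge_1[OF N _ edges] by blast
    moreover have "L' \<le> L" using L(1) \<beta>(2) by (simp add: L'_def mult_left_le)
    moreover have "\<Phi> L' + c \<le> \<Phi> L"
      using drop[of L] L(1,2) \<open>1 \<le> L'\<close> unfolding L'_def by blast
    ultimately show ?case
      unfolding k(3) using edges L(2) \<Phi>L by (intro exI[of _ L']) (auto simp: algebra_simps)
  qed
  from this[of l] nonneg show ?thesis by force
qed

text \<open>Here the energy is the edge bound itself: it is at least \<open>1\<close>, so a relative decrease by
  \<open>2 * \<delta> / 3\<close> is an absolute one.\<close>

lemma property_beta_levels:
  fixes N :: "'y::real_normed_vector \<Rightarrow> real"
  assumes N: "equivalent_norm N" and beta: "property_beta N" and "0 < D"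
  shows "\<exists>c>0. \<forall>l f. noncontractive N l f \<and> edges_within N l 0 f D \<longrightarrow> c * real l \<le> D"
proof -
  obtain \<delta> where "0 < \<delta>" and \<delta>: "\<And>t. 2 / D \<le> t \<Longrightarrow> beta_gap N t \<delta>"
    using property_beta_gap[OF N beta, of "2 / D"] \<open>0 < D\<close> by auto
  have "2 * \<delta> / 3 * real l \<le> D" if "noncontractive N l f" "edges_within N l 0 f D" for l f
  proof (rule levels_le_energy[where \<beta> = "\<lambda>_. \<delta>" and \<Phi> = "\<lambda>L. L", OF N that])
    fix L :: real assume "1 \<le> L" "L \<le> D"
    then show "beta_gap N (2 / L) \<delta> \<and> 0 \<le> \<delta>"
      using \<open>0 < \<delta>\<close> by (intro conjI \<delta>) (auto simp: frac_le)
    have "1 * (2 * \<delta> / 3) \<le> L * (2 * \<delta> / 3)"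
      using \<open>1 \<le> L\<close> \<open>0 < \<delta>\<close> by (intro mult_right_mono) auto
    then show "L * (1 - 2 * \<delta> / 3) + 2 * \<delta> / 3 \<le> L" by (simp add: algebra_simps)
  qed simp
  with \<open>0 < \<delta>\<close> show ?thesis by (intro exI[of _ "2 * \<delta> / 3"]) auto
qed

text \<open>With $c = (2\gamma/3)2^p$ and $q = c/L^p$ the new edge bound is $L(1-q)$, and $(1-q)^p \le 1-q$ makes the \<open>p\<close>-th power
  drop from $L^p$ to at most $L^p - c$.\<close>

lemma property_beta_power_levels:
  fixes f :: "pvertex \<Rightarrow> 'y::real_normed_vector"
  assumes p: "1 \<le> p" and \<gamma>: "0 \<le> \<gamma>" and power: "property_beta_power (norm :: 'y \<Rightarrow> real) p \<gamma>"
    and f: "noncontractive norm l f" and D: "edges_within norm l 0 f D"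
  shows "2 * \<gamma> / 3 * 2 powr p * real l \<le> D powr p"
proof (rule levels_le_energy[where \<beta> = "\<lambda>L. \<gamma> * (2 / L) powr p" and \<Phi> = "\<lambda>L. L powr p",
      OF equivalent_norm_norm f D])
  fix L :: real assume "1 \<le> L"
  then show "beta_gap (norm :: 'y \<Rightarrow> real) (2 / L) (\<gamma> * (2 / L) powr p) \<and> 0 \<le> \<gamma> * (2 / L) powr p"
    using \<gamma> property_beta_power_gap[OF power] by simp
  define q where "q = 2 * (\<gamma> * (2 / L) powr p) / 3"
  have q: "L powr p * q = 2 * \<gamma> / 3 * 2 powr p"
    using \<open>1 \<le> L\<close> by (simp add: q_def powr_divide)
  assume "1 \<le> L * (1 - 2 * (\<gamma> * (2 / L) powr p) / 3)"
  then have "0 < L * (1 - q)" by (simp add: q_def)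
  then have "0 < 1 - q" using \<open>1 \<le> L\<close> by (simp add: zero_less_mult_iff)
  moreover have "0 \<le> q" using \<gamma> by (simp add: q_def)
  ultimately have "(1 - q) powr p \<le> 1 - q" using p by (intro powr_le_one_le) auto
  then have "(L * (1 - q)) powr p \<le> L powr p * (1 - q)"
    using \<open>1 \<le> L\<close> \<open>0 < 1 - q\<close> by (simp add: powr_mult mult_left_mono)
  also have "\<dots> = L powr p - 2 * \<gamma> / 3 * 2 powr p"
    unfolding q[symmetric] by (simp add: algebra_simps)
  finally have "(L * (1 - q)) powr p + 2 * \<gamma> / 3 * 2 powr p \<le> L powr p" by linarith
  then show "(L * (1 - 2 * (\<gamma> * (2 / L) powr p) / 3)) powr p + 2 * \<gamma> / 3 * 2 powr p \<le> L powr p"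
    unfolding q_def .
qed simp

section \<open>Normalising a bi-Lipschitz embedding\<close>

lemma Lipschitz_constants_nonempty:
  assumes "Lipschitz_continuous_map X Y f"
  shows "{K. 0 \<le> K \<and>
    (\<forall>x\<in>mspace X. \<forall>y\<in>mspace X. mdist Y (f x) (f y) \<le> K * mdist X x y)} \<noteq> {}"
proof -
  from assms obtain B where
    B: "\<forall>x\<in>mspace X. \<forall>y\<in>mspace X. mdist Y (f x) (f y) \<le> B * mdist X x y"
    unfolding Lipschitz_continuous_map_def by blast
  have "B * mdist X x y \<le> max B 0 * mdist X x y" for x y
    by (rule mult_right_mono) auto
  with B have "\<forall>x\<in>mspace X. \<forall>y\<in>mspace X. mdist Y (f x) (f y) \<le> max B 0 * mdist X x y"
    by (meson order_trans)
  then show ?thesis by (auto intro!: exI[of _ "max B 0"])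
qed

lemma Lip_nonneg:
  assumes "Lipschitz_continuous_map X Y f"
  shows "0 \<le> Lip X Y f"
  unfolding Lip_def by (rule cInf_greatest[OF Lipschitz_constants_nonempty[OF assms]]) simp

text \<open>The infimum defining the Lipschitz constant is attained: for each pair of distinct points, the
  quotient of distances is a lower bound of all admissible constants, hence of their infimum.\<close>

lemma Lip_bound:
  assumes f: "Lipschitz_continuous_map X Y f" and xy: "x \<in> mspace X" "y \<in> mspace X"
  shows "mdist Y (f x) (f y) \<le> Lip X Y f * mdist X x y"
proof (cases "x = y")
  case True
  have "f y \<in> mspace Y" using f xy by (auto simp: Lipschitz_continuous_map_def)
  then have "mdist Y (f y) (f y) = 0" "mdist X y y = 0" using xy by simp_all
  then show ?thesis using True by simp
next
  case False
  then have "0 < mdist X x y"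
    using xy mdist_nonneg[of X x y] mdist_zero[of x X y] by (simp add: less_le)
  moreover from this have "mdist Y (f x) (f y) / mdist X x y \<le> Lip X Y f"
    unfolding Lip_def using xy
    by (intro cInf_greatest[OF Lipschitz_constants_nonempty[OF f]]) (simp add: pos_divide_le_eq)
  ultimately show ?thesis by (simp add: pos_divide_le_eq)
qed

lemma distortion_nonneg:
  assumes "bi_Lipschitz_embedding X Y f"
  shows "0 \<le> distortion X Y f"
  using assms unfolding distortion_def bi_Lipschitz_embedding_def by (simp add: Lip_nonneg)

text \<open>Multiplying by the Lipschitz constant of the inverse makes the embedding noncontractive for the
  given norm, and its Lipschitz constant becomes the distortion. Dividing by \<open>a\<close> in addition makes it
  noncontractive for \<open>N\<close>, at the price of the factor \<open>b / a\<close> in the upper bound.\<close>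

lemma embedding_normalised:
  fixes N :: "'y::real_normed_vector \<Rightarrow> real" and f :: "pvertex \<Rightarrow> 'y"
  assumes N: "equivalent_norm N" and ab: "0 < a" "0 < b"
    and bounds: "\<And>x. a * norm x \<le> N x \<and> N x \<le> b * norm x"
    and f: "bi_Lipschitz_embedding (parasol l) euclidean_metric f"
  shows "\<exists>g. noncontractive N l g \<and>
             edges_within N l 0 g (b / a * distortion (parasol l) euclidean_metric f)"
proof -
  let ?V = "parasol_vertices l" and ?d = "graph_dist (parasol_edges l)"
  let ?S = "submetric euclidean_metric (f ` ?V)"
  define K where "K = Lip (parasol l) euclidean_metric f"
  define K' where "K' = Lip ?S (parasol l) (inv_into ?V f)"
  have inj: "inj_on f ?V"
    and f_Lip: "Lipschitz_continuous_map (parasol l) euclidean_metric f"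
    and inv_Lip: "Lipschitz_continuous_map ?S (parasol l) (inv_into ?V f)"
    using f by (auto simp: bi_Lipschitz_embedding_def)
  have upper: "norm (f x - f y) \<le> K * ?d x y" if "x \<in> ?V" "y \<in> ?V" for x y
    using Lip_bound[OF f_Lip, of x y] that by (simp add: K_def dist_norm)
  have lower: "?d x y \<le> K' * norm (f x - f y)" if "x \<in> ?V" "y \<in> ?V" for x y
    using Lip_bound[OF inv_Lip, of "f x" "f y"] that inj
    by (simp add: K'_def dist_norm)
  have "0 \<le> K'" unfolding K'_def by (rule Lip_nonneg[OF inv_Lip])
  have "0 \<le> K" unfolding K_def by (rule Lip_nonneg[OF f_Lip])
  define g where "g = (\<lambda>x. (K' / a) *\<^sub>R f x)"
  have Ng: "N (g x - g y) = K' / a * N (f x - f y)" for x y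
    using \<open>0 \<le> K'\<close> ab
    by (simp add: g_def equivalent_norm_scaleR[OF N] flip: scaleR_diff_right)
  have "?d x y \<le> N (g x - g y)" if "x \<in> ?V" "y \<in> ?V" for x y
  proof -
    have "?d x y \<le> K' / a * (a * norm (f x - f y))" using lower[OF that] ab by simp
    also have "\<dots> \<le> N (g x - g y)"
      unfolding Ng using bounds \<open>0 \<le> K'\<close> ab by (intro mult_left_mono) auto
    finally show ?thesis .
  qed
  moreover have "N (g v - g u) \<le> b / a * (K * K')" if e: "(u, v) \<in> parasol_edges l" for u v
  proof -
    have "norm (f v - f u) \<le> K * ?d u v"
      using upper[of u v] parasol_edge_vertices[OF e] by (simp add: norm_minus_commute)
    also have "\<dots> \<le> K" using graph_dist_edge_le_1[OF e] \<open>0 \<le> K\<close> by (simp add: mult_left_le)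
    finally have "b * norm (f v - f u) \<le> b * K" using ab by simp
    then have "N (f v - f u) \<le> b * K" using bounds[of "f v - f u"] by linarith
    then have "N (g v - g u) \<le> K' / a * (b * K)"
      unfolding Ng using \<open>0 \<le> K'\<close> ab by (intro mult_left_mono) auto
    then show ?thesis by (simp add: mult_ac)
  qed
  ultimately show ?thesis
    by (intro exI[of _ g])
      (auto simp: noncontractive_def edges_within_def distortion_def K_def K'_def)
qed

section \<open>Lower bounds for the distortion\<close>

lemma least_distortion_unbounded:
  fixes N :: "'y::real_normed_vector \<Rightarrow> real"
  assumes N: "equivalent_norm N" and beta: "property_beta N"
  shows "(SUP l\<in>{1..}. least_distortion (euclidean_metric :: 'y metric) (parasol l)) = \<infinity>"
proof (rule ccontr)
  let ?c = "\<lambda>l. least_distortion (euclidean_metric :: 'y metric) (parasol l)"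
  assume "(SUP l\<in>{1..}. ?c l) \<noteq> \<infinity>"
  then obtain n :: nat where "(SUP l\<in>{1..}. ?c l) < ereal (real n)"
    unfolding less_PInf_Ex_of_nat by blast
  then have n: "(SUP l\<in>{1..}. ?c l) \<le> ereal (real n)" by (rule less_imp_le)
  obtain a b where ab: "0 < a" "0 < b" and bounds: "\<And>x. a * norm x \<le> N x \<and> N x \<le> b * norm x"
    using N unfolding equivalent_norm_def by blast
  \<comment> \<open>The summand \<open>1\<close> leaves room for an embedding whose distortion exceeds the infimum.\<close>
  define D where "D = b / a * (real n + 1)"
  have "0 < D" using ab by (simp add: D_def)
  obtain c where "0 < c"
    and c: "\<And>l f. noncontractive N l f \<Longrightarrow> edges_within N l 0 f D \<Longrightarrow> c * real l \<le> D"
    using property_beta_levels[OF N beta \<open>0 < D\<close>] by blast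
  obtain l :: nat where l: "D / c < real l" using reals_Archimedean2 by blast
  have "0 < D / c" using \<open>0 < D\<close> \<open>0 < c\<close> by simp
  with l have "0 < real l" by linarith
  then have "l \<in> {1..}" by simp
  then have "?c l \<le> ereal (real n)" using n by (meson SUP_upper order_trans)
  also have "\<dots> < ereal (real n + 1)" by simp
  finally obtain f :: "pvertex \<Rightarrow> 'y"
    where f: "bi_Lipschitz_embedding (parasol l) euclidean_metric f"
      and "distortion (parasol l) euclidean_metric f < real n + 1"
    unfolding least_distortion_def INF_less_iff by auto
  then have le: "b / a * distortion (parasol l) euclidean_metric f \<le> D"
    unfolding D_def using ab by (intro mult_left_mono) auto
  obtain g where g: "noncontractive N l g"
    "edges_within N l 0 g (b / a * distortion (parasol l) euclidean_metric f)"
    using embedding_normalised[OF N ab bounds f] by blast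
  then have "edges_within N l 0 g D" using le by (force simp: edges_within_def)
  with c g(1) have "c * real l \<le> D" by blast
  with l \<open>0 < c\<close> show False by (simp add: pos_divide_less_eq mult.commute)
qed

lemma least_distortion_power_bound:
  assumes p: "1 \<le> p" and \<gamma>: "0 \<le> \<gamma>"
    and power: "property_beta_power (norm :: 'y::real_normed_vector \<Rightarrow> real) p \<gamma>"
  shows "ereal (2 * (2 * \<gamma> / 3) powr (1 / p) * real l powr (1 / p))
           \<le> least_distortion (euclidean_metric :: 'y metric) (parasol l)"
  unfolding least_distortion_def
proof (rule INF_greatest, clarify)
  fix f :: "pvertex \<Rightarrow> 'y" assume f: "bi_Lipschitz_embedding (parasol l) euclidean_metric f"
  define D where "D = distortion (parasol l) euclidean_metric f"
  have "0 \<le> D" unfolding D_def by (rule distortion_nonneg[OF f])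
  obtain g :: "pvertex \<Rightarrow> 'y" where g: "noncontractive norm l g" "edges_within norm l 0 g D"
    using embedding_normalised[OF equivalent_norm_norm, of 1 1 l f] f by (auto simp: D_def)
  have "2 * c powr (1 / p) * real l powr (1 / p) = (c * 2 powr p * real l) powr (1 / p)"
    if "0 \<le> c" for c
    using p that by (simp add: powr_mult powr_powr)
  from this[of "2 * \<gamma> / 3"]
  have "2 * (2 * \<gamma> / 3) powr (1 / p) * real l powr (1 / p)
      = (2 * \<gamma> / 3 * 2 powr p * real l) powr (1 / p)"
    using \<gamma> by simp
  also have "\<dots> \<le> (D powr p) powr (1 / p)"
    using property_beta_power_levels[OF p \<gamma> power g] p \<gamma> by (intro powr_mono2) auto
  also have "\<dots> = D" using p \<open>0 \<le> D\<close> by (simp add: powr_powr)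
  finally show "ereal (2 * (2 * \<gamma> / 3) powr (1 / p) * real l powr (1 / p))
      \<le> ereal (distortion (parasol l) euclidean_metric f)"
    by (simp add: D_def)
qed

theorem theorem2p2:
  shows "((\<exists>N :: 'y::banach \<Rightarrow> real. equivalent_norm N \<and> property_beta N) \<longrightarrow>
            (SUP l\<in>{1..}. least_distortion (euclidean_metric :: 'y metric) (parasol l)) = \<infinity>)
       \<and> (\<forall>(p::real) (\<gamma>::real). 1 < p \<and> 0 < \<gamma> \<and> property_beta_power (norm :: 'y \<Rightarrow> real) p \<gamma> \<longrightarrow>
            (\<forall>l\<ge>1. least_distortion (euclidean_metric :: 'y metric) (parasol l)
                      \<ge> ereal (2 * (2 * \<gamma> / 3) powr (1 / p) * real l powr (1 / p))))"
proof (intro conjI allI impI; (elim exE conjE)?)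
  fix N :: "'y \<Rightarrow> real" assume "equivalent_norm N" "property_beta N"
  then show "(SUP l\<in>{1..}. least_distortion (euclidean_metric :: 'y metric) (parasol l)) = \<infinity>"
    by (rule least_distortion_unbounded)
next
  fix p \<gamma> :: real and l :: nat
  assume "1 < p" "0 < \<gamma>" "property_beta_power (norm :: 'y \<Rightarrow> real) p \<gamma>"
  then show "ereal (2 * (2 * \<gamma> / 3) powr (1 / p) * real l powr (1 / p))
      \<le> least_distortion (euclidean_metric :: 'y metric) (parasol l)"
    by (intro least_distortion_power_bound) auto
qed

end
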